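(* Let $G=(X\cup Y,E)$ be a simple $d$-regular bipartite graph with classes $X,Y$, and let $k\ge1$ and $1\le t\le k$. Then for any two templates $\tau,\tau'\in\{\mathcal X,\mathcal Y\}^k$, the graphs $BGP_{k,t,\tau}(G)$ and $BGP_{k,t,\tau'}(G)$ are cospectral (their adjacency matrices have the same multiset of eigenvalues).
   Context: A template is a string $\tau=(\tau_1,\ldots,\tau_k)\in\{\mathcal X,\mathcal Y\}^k$; its complement $\tau^c$ swaps $\mathcal X$ and $\mathcal Y$ in every position. A tuple $(a_1,\ldots,a_k)\in(X\cup Y)^k$ has template $\tau$ iff $a_i\in X$ whenever $\tau_i=\mathcal X$ and $a_i\in Y$ whenever $\tau_i=\mathcal Y$; $V_\tau$ denotes the set of tuples with template $\tau$. $BGP_{k,t,\tau}(G)$ is the graph with vertex set $V_\tau\cup V_{\tau^c}$ in which ${\bf a}$ and ${\bf b}$ are adjacent iff at least $t$ of the pairs $\{a_i,b_i\}$ are edges of $G$.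
   Formalization: The formal theorem additionally assumes d ≥ 1 or |X| = |Y|; for d = 0 with classes of unequal size the claim fails (|X|=1, |Y|=2, no edges, k=2 gives graphs with 5 and 4 vertices). *)

theory Defs
  imports "Jordan_Normal_Form.Char_Poly"
begin

text \<open>A simple graph is a pair of a vertex set and a set of edges, each edge a two-element set
  of vertices.\<close>

type_synonym 'a ugraph = "'a set \<times> 'a set set"

abbreviation verts :: "'a ugraph \<Rightarrow> 'a set" where
  "verts G \<equiv> fst G"

abbreviation edges :: "'a ugraph \<Rightarrow> 'a set set" where
  "edges G \<equiv> snd G"

text \<open>Since the classes are disjoint, the condition on the edges also excludes loops.\<close>

definition bipartite_graph :: "'a ugraph \<Rightarrow> 'a set \<Rightarrow> 'a set \<Rightarrow> bool" where
  "bipartite_graph G X Y \<longleftrightarrow>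
     finite (verts G) \<and> verts G = X \<union> Y \<and> X \<inter> Y = {} \<and>
     (\<forall>e\<in>edges G. \<exists>x\<in>X. \<exists>y\<in>Y. e = {x, y})"

text \<open>For \<open>d \<ge> 1\<close> a \<open>d\<close>-regular bipartite graph has classes of equal size. For \<open>d = 0\<close> the class
  sizes are arbitrary, and then the graphs \<open>BGP\<close> below may have different numbers of vertices for
  different templates.\<close>

definition regular_graph :: "nat \<Rightarrow> 'a ugraph \<Rightarrow> bool" where
  "regular_graph d G \<longleftrightarrow> (\<forall>v\<in>verts G. card {u \<in> verts G. {v, u} \<in> edges G} = d)"

datatype side = SideX | SideY

type_synonym template = "side list"

fun swap_side :: "side \<Rightarrow> side" where
  "swap_side SideX = SideY"
| "swap_side SideY = SideX"

definition complement :: "template \<Rightarrow> template" where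
  "complement \<tau> = map swap_side \<tau>"

fun side_set :: "'a set \<Rightarrow> 'a set \<Rightarrow> side \<Rightarrow> 'a set" where
  "side_set X Y SideX = X"
| "side_set X Y SideY = Y"

definition template_tuples :: "'a set \<Rightarrow> 'a set \<Rightarrow> template \<Rightarrow> 'a list set" where
  "template_tuples X Y \<tau> =
     {a. length a = length \<tau> \<and> (\<forall>i<length \<tau>. a ! i \<in> side_set X Y (\<tau> ! i))}"

text \<open>For \<open>t \<ge> 1\<close> and loopless \<open>G\<close> no tuple is adjacent to itself, so this is a simple graph.\<close>

definition BGP :: "nat \<Rightarrow> nat \<Rightarrow> template \<Rightarrow> 'a set \<Rightarrow> 'a set \<Rightarrow> 'a ugraph \<Rightarrow> 'a list ugraph" where
  "BGP k t \<tau> X Y G =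
     (let V = template_tuples X Y \<tau> \<union> template_tuples X Y (complement \<tau>)
      in (V, {{a, b} | a b. a \<in> V \<and> b \<in> V \<and> t \<le> card {i. i < k \<and> {a ! i, b ! i} \<in> edges G}}))"

text \<open>The adjacency matrix depends on an enumeration \<open>vs\<close> of the vertices.\<close>

definition adjacency_matrix :: "'a ugraph \<Rightarrow> 'a list \<Rightarrow> complex mat" where
  "adjacency_matrix G vs =
     mat (length vs) (length vs) (\<lambda>(i, j). if {vs ! i, vs ! j} \<in> edges G then 1 else 0)"

text \<open>Eigenvalues are counted with algebraic multiplicity, which is also the geometric one for
  adjacency matrices, as these are real symmetric.\<close>

definition eigenvalue_mset :: "complex mat \<Rightarrow> complex multiset" where
  "eigenvalue_mset A = proots (char_poly A)"

text \<open>Reordering the vertices conjugates the adjacency matrix by a permutation matrix, so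
  demanding equality for all enumerations is the same as demanding it for one. Finiteness
  guarantees that enumerations exist.\<close>

definition cospectral :: "'a ugraph \<Rightarrow> 'b ugraph \<Rightarrow> bool" where
  "cospectral G H \<longleftrightarrow>
     finite (verts G) \<and> finite (verts H) \<and>
     (\<forall>vs ws. distinct vs \<longrightarrow> set vs = verts G \<longrightarrow> distinct ws \<longrightarrow> set ws = verts H \<longrightarrow>
        eigenvalue_mset (adjacency_matrix G vs) = eigenvalue_mset (adjacency_matrix H ws))"

end

theory Submission
  imports Defs "Jordan_Normal_Form.Schur_Decomposition"
begin

text \<open>The spectrum is determined by the numbers of closed walks of each length. A closed walk in
  the product is a \<open>k\<close>-tuple of closed walks in \<open>G\<close> whose steps may also be non-edges between
  opposite classes; whether the tuple is allowed depends only on which steps are edges. So it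
  suffices that, for each pattern of edges and non-edges, as many closed walks start in \<open>X\<close> as in
  \<open>Y\<close>. By regularity the edge and non-edge kernels commute, so the number of walks with a given
  pattern does not change when the pattern is rotated, which moves the starting point to the
  other class.\<close>

section \<open>Power sums of eigenvalues\<close>

text \<open>Equal power sums give equal sums of any polynomial over the two multisets. A polynomial
  that vanishes on all elements except \<open>z\<close> isolates the multiplicity of
  \<open>z\<close>.\<close>

lemma multiset_eq_if_power_sums_eq:
  fixes M N :: "'a::{idom,ring_char_0} multiset"
  assumes "\<And>m. (\<Sum>x\<in>#M. x ^ m) = (\<Sum>x\<in>#N. x ^ m)"
  shows "M = N"
proof (rule multiset_eqI)
  fix z
  define S where "S = set_mset M \<union> set_mset N - {z}"
  \<comment> \<open>An unnormalised Lagrange polynomial: its value at \<open>z\<close> is only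
    nonzero, so no division is required, and it is cancelled at the end.\<close>
  define p where "p = (\<Prod>y\<in>S. [:- y, 1:])"
  have S: "finite S" by (simp add: S_def)
  have poly_sum: "(\<Sum>x\<in>#L. poly p x) = (\<Sum>i\<le>degree p. coeff p i * (\<Sum>x\<in>#L. x ^ i))" for L
    by (induction L) (simp_all add: poly_altdef sum.distrib algebra_simps)
  have pz: "poly p z \<noteq> 0"
    using S by (auto simp: p_def poly_prod S_def)
  have p0: "poly p x = 0" if "x \<in> S" for x
    using S that by (auto simp: p_def poly_prod)
  have single: "(\<Sum>x\<in>#L. poly p x) = of_nat (count L z) * poly p z"
    if "set_mset L \<subseteq> insert z S" for L
    using that by (induction L) (auto simp: p0 algebra_simps)
  have "(\<Sum>x\<in>#M. poly p x) = (\<Sum>x\<in>#N. poly p x)"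
    unfolding poly_sum assms ..
  moreover have "set_mset M \<subseteq> insert z S" "set_mset N \<subseteq> insert z S"
    by (auto simp: S_def)
  ultimately have "of_nat (count M z) * poly p z = of_nat (count N z) * poly p z"
    by (metis single)
  then show "count M z = count N z" using pz by simp
qed

section \<open>Traces of powers via triangularisation\<close>

lemma sum_list_diag_mat:
  "sum_list (diag_mat A) = (\<Sum>i<dim_row A. A $$ (i, i))"
  by (simp add: diag_mat_def interv_sum_list_conv_sum_set_nat lessThan_atLeast0)

lemma trace_mult_commute:
  fixes A B :: "'a::comm_semiring_0 mat"
  assumes "A \<in> carrier_mat n m" "B \<in> carrier_mat m n"
  shows "sum_list (diag_mat (A * B)) = sum_list (diag_mat (B * A))"
proof -
  have "sum_list (diag_mat (A * B)) = (\<Sum>i<n. \<Sum>j<m. A $$ (i, j) * B $$ (j, i))"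
    using assms by (simp add: sum_list_diag_mat scalar_prod_def lessThan_atLeast0)
  also have "\<dots> = (\<Sum>j<m. \<Sum>i<n. B $$ (j, i) * A $$ (i, j))"
    by (subst sum.swap) (simp add: mult.commute)
  also have "\<dots> = sum_list (diag_mat (B * A))"
    using assms by (simp add: sum_list_diag_mat scalar_prod_def lessThan_atLeast0)
  finally show ?thesis .
qed

lemma upper_triangular_mult:
  fixes A B :: "'a::semiring_0 mat"
  assumes A: "A \<in> carrier_mat n n" "upper_triangular A"
    and B: "B \<in> carrier_mat n n" "upper_triangular B"
  shows "upper_triangular (A * B)"
    and "i < n \<Longrightarrow> (A * B) $$ (i, i) = A $$ (i, i) * B $$ (i, i)"
proof -
  have entry: "(A * B) $$ (i, j) = (\<Sum>l<n. A $$ (i, l) * B $$ (l, j))" if "i < n" "j < n" for i j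
    using A B that by (simp add: scalar_prod_def lessThan_atLeast0)
  \<comment> \<open>A term can survive only for \<open>i\<close> \<le> \<open>l\<close> \<le>
    \<open>j\<close>: no such \<open>l\<close> exists below the diagonal, and only
    \<open>l = i\<close> on it.\<close>
  have zero: "A $$ (i, l) * B $$ (l, j) = 0" if "i < n" "l < n" "j < l \<or> l < i" for i j l
    using A B that by (auto dest: upper_triangularD)
  show "upper_triangular (A * B)"
  proof
    fix i j assume "j < i" "i < dim_row (A * B)"
    then have "i < n" "j < n" using A by auto
    moreover have "(\<Sum>l<n. A $$ (i, l) * B $$ (l, j)) = 0"
      using zero \<open>i < n\<close> \<open>j < i\<close> by (intro sum.neutral ballI) (metis lessThan_iff linorder_neqE_nat order.strict_trans)
    ultimately show "(A * B) $$ (i, j) = 0" by (simp add: entry)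
  qed
  show "(A * B) $$ (i, i) = A $$ (i, i) * B $$ (i, i)" if "i < n"
  proof -
    have "(\<Sum>l<n. A $$ (i, l) * B $$ (l, i)) = (\<Sum>l\<in>{i}. A $$ (i, l) * B $$ (l, i))"
      using zero[OF that] that by (intro sum.mono_neutral_right) (auto intro: linorder_cases)
    then show ?thesis using that by (simp add: entry)
  qed
qed

lemma upper_triangular_pow:
  fixes A :: "'a::semiring_1 mat"
  assumes A: "A \<in> carrier_mat n n" "upper_triangular A"
  shows "upper_triangular (A ^\<^sub>m m)"
    and "i < n \<Longrightarrow> (A ^\<^sub>m m) $$ (i, i) = (A $$ (i, i)) ^ m"
proof -
  have "upper_triangular (A ^\<^sub>m m) \<and> (\<forall>i<n. (A ^\<^sub>m m) $$ (i, i) = (A $$ (i, i)) ^ m)"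
  proof (induction m)
    case 0
    then show ?case using A by auto
  next
    case (Suc m)
    have "A ^\<^sub>m m \<in> carrier_mat n n" using A by simp
    then show ?case
      using upper_triangular_mult[of "A ^\<^sub>m m" n A] A Suc by (simp add: power_commutes)
  qed
  then show "upper_triangular (A ^\<^sub>m m)"
    and "i < n \<Longrightarrow> (A ^\<^sub>m m) $$ (i, i) = (A $$ (i, i)) ^ m"
    by auto
qed

lemma proots_prod_list_linear:
  "proots (\<Prod>a\<leftarrow>as. [:- a, 1:]) = mset (as :: 'a::idom list)"
proof (induction as)
  case (Cons a as)
  have "(\<Prod>a\<leftarrow>as. [:- a, 1:]) \<noteq> 0" by (auto simp: prod_list_zero_iff)
  then show ?case
    using Cons by (simp add: proots_mult del: mult_pCons_left)
qed simp

text \<open>Schur decomposition makes \<open>A\<close> similar to a triangular \<open>B\<close>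
  whose diagonal lists the roots of the characteristic polynomial with multiplicity. The trace is
  invariant under similarity, and powers of \<open>B\<close> have the powers of its diagonal entries
  on the diagonal.\<close>

lemma trace_pow_eq_power_sum:
  fixes A :: "complex mat"
  assumes A: "A \<in> carrier_mat n n"
  shows "sum_list (diag_mat (A ^\<^sub>m m)) = (\<Sum>x\<in>#eigenvalue_mset A. x ^ m)"
proof -
  obtain es where es: "char_poly A = (\<Prod>a\<leftarrow>es. [:- a, 1:])"
    using char_poly_factorized[OF A] by blast
  obtain B P Q where "schur_decomposition A es = (B, P, Q)"
    by (cases "schur_decomposition A es")
  from schur_decomposition[OF A es this]
  have sim: "similar_mat_wit A B P Q" and B: "upper_triangular B" and diag: "diag_mat B = es"
    by auto
  note car = similar_mat_witD2[OF A sim]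
  note pow = similar_mat_witD2[OF pow_carrier_mat[OF A] similar_mat_wit_pow[OF sim, of m]]
  have "sum_list (diag_mat (A ^\<^sub>m m)) = sum_list (diag_mat (P * (B ^\<^sub>m m * Q)))"
    using pow by (simp add: assoc_mult_mat[of _ n n _ n _ n])
  also have "\<dots> = sum_list (diag_mat (B ^\<^sub>m m * Q * P))"
    using pow by (intro trace_mult_commute[of _ n n]) auto
  also have "B ^\<^sub>m m * Q * P = B ^\<^sub>m m"
    using pow by (simp add: assoc_mult_mat[of _ n n _ n _ n] right_mult_one_mat[of _ n n])
  also have "sum_list (diag_mat (B ^\<^sub>m m)) = (\<Sum>i<n. (B $$ (i, i)) ^ m)"
    using upper_triangular_pow(2)[OF car(5) B] car by (simp add: sum_list_diag_mat)
  also have "\<dots> = (\<Sum>x\<leftarrow>diag_mat B. x ^ m)"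
    using car by (simp add: diag_mat_def comp_def interv_sum_list_conv_sum_set_nat lessThan_atLeast0)
  also have "\<dots> = (\<Sum>x\<in>#eigenvalue_mset A. x ^ m)"
    unfolding eigenvalue_mset_def es proots_prod_list_linear diag
    by (simp flip: sum_mset_sum_list)
  finally show ?thesis .
qed

section \<open>Weighted walks\<close>

text \<open>The \<open>(u, v)\<close> entry of a product of matrices indexed by \<open>W\<close>,
  one factor per step. Kernels as functions avoid an enumeration of the vertices, and a list of them
  allows steps of different kinds.\<close>

fun walk_weight :: "'v set \<Rightarrow> ('v \<Rightarrow> 'v \<Rightarrow> 'a) list \<Rightarrow> 'v \<Rightarrow> 'v \<Rightarrow> 'a::comm_semiring_1" where
  "walk_weight W [] u v = of_bool (u = v)"
| "walk_weight W (M # Ms) u v = (\<Sum>w\<in>W. M u w * walk_weight W Ms w v)"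

text \<open>Associativity of the matrix product: the last factor can be split off instead of the
  first. Matrix powers grow on the right, and rotating a closed walk also moves a step to the
  end.\<close>

lemma walk_weight_snoc:
  assumes "finite W" "u \<in> W" "v \<in> W"
  shows "walk_weight W (Ms @ [M]) u v = (\<Sum>w\<in>W. walk_weight W Ms u w * M w v)"
  using assms(2)
proof (induction Ms arbitrary: u)
  case Nil
  have "(\<Sum>w\<in>W. M u w * of_bool (w = v)) = M u v"
    using assms by (simp add: of_bool_def if_distrib[of "(*) _"] cong: if_cong)
  moreover have "(\<Sum>w\<in>W. of_bool (u = w) * M w v) = M u v"
    using assms Nil by (simp add: of_bool_def if_distrib[of "\<lambda>x. x * _"] cong: if_cong)
  ultimately show ?case by simp
next
  case (Cons N Ms)
  then show ?case
    by (simp add: sum_distrib_left sum_distrib_right mult.assoc cong: sum.cong) (rule sum.swap)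
qed

lemma trace_adjacency_pow:
  assumes vs: "distinct vs"
  shows "sum_list (diag_mat (adjacency_matrix G vs ^\<^sub>m m)) =
    (\<Sum>v\<in>set vs. walk_weight (set vs) (replicate m (\<lambda>u w. of_bool ({u, w} \<in> edges G))) v v)"
proof -
  let ?n = "length vs" and ?A = "adjacency_matrix G vs"
  let ?f = "\<lambda>u w. of_bool ({u, w} \<in> edges G)"
  have A: "?A \<in> carrier_mat ?n ?n" by (simp add: adjacency_matrix_def)
  have sum_vs: "(\<Sum>v\<in>set vs. g v) = (\<Sum>i<?n. g (vs ! i))" for g :: "'a \<Rightarrow> complex"
    using vs by (simp add: sum.distinct_set_conv_list sum_list_sum_nth lessThan_atLeast0)
  have entry: "(?A ^\<^sub>m m) $$ (i, j) = walk_weight (set vs) (replicate m ?f) (vs ! i) (vs ! j)"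
    if "i < ?n" "j < ?n" for i j
    using that
  proof (induction m arbitrary: j)
    case 0
    then show ?case using vs A by (auto simp: nth_eq_iff_index_eq)
  next
    case (Suc m)
    have "(?A ^\<^sub>m Suc m) $$ (i, j) = (\<Sum>l<?n. (?A ^\<^sub>m m) $$ (i, l) * ?A $$ (l, j))"
      using Suc.prems A by (simp add: scalar_prod_def lessThan_atLeast0)
    also have "\<dots> = (\<Sum>l<?n. walk_weight (set vs) (replicate m ?f) (vs ! i) (vs ! l) * ?f (vs ! l) (vs ! j))"
      using Suc by (intro sum.cong) (auto simp: adjacency_matrix_def)
    also have "\<dots> = walk_weight (set vs) (replicate m ?f @ [?f]) (vs ! i) (vs ! j)"
      using Suc.prems by (subst walk_weight_snoc) (auto simp: sum_vs)
    finally show ?case by (simp only: replicate_append_same replicate_Suc)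
  qed
  show ?thesis
    using A by (simp add: sum_list_diag_mat entry sum_vs)
qed

text \<open>Closed walk counts are traces of powers of the adjacency matrix, hence power sums of
  eigenvalues, and these determine the spectrum. The case \<open>m = 0\<close> compares the numbers
  of vertices.\<close>

lemma cospectral_if_closed_walks_eq:
  assumes "finite (verts G)" "finite (verts H)"
    and "\<And>m. (\<Sum>v\<in>verts G. walk_weight (verts G) (replicate m (\<lambda>u w. of_bool ({u, w} \<in> edges G))) v v) =
      (\<Sum>v\<in>verts H. walk_weight (verts H) (replicate m (\<lambda>u w. of_bool ({u, w} \<in> edges H))) v v :: complex)"
  shows "cospectral G H"
  unfolding cospectral_def
proof (intro conjI allI impI assms)
  fix vs ws
  assume "distinct vs" "set vs = verts G" "distinct ws" "set ws = verts H"
  then have "(\<Sum>x\<in>#eigenvalue_mset (adjacency_matrix G vs). x ^ m) =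
      (\<Sum>x\<in>#eigenvalue_mset (adjacency_matrix H ws). x ^ m)" for m
    using assms(3)[of m] trace_adjacency_pow[of vs G m] trace_adjacency_pow[of ws H m]
      trace_pow_eq_power_sum[of "adjacency_matrix G vs" "length vs" m]
      trace_pow_eq_power_sum[of "adjacency_matrix H ws" "length ws" m]
    by (simp add: adjacency_matrix_def)
  then show "eigenvalue_mset (adjacency_matrix G vs) = eigenvalue_mset (adjacency_matrix H ws)"
    by (rule multiset_eq_if_power_sums_eq)
qed

section \<open>Sums over tuples\<close>

lemma sum_set_Cons:
  "(\<Sum>a\<in>set_Cons A L. g a) = (\<Sum>x\<in>A. \<Sum>xs\<in>L. g (x # xs))"
proof -
  have eq: "set_Cons A L = (\<lambda>(x, xs). x # xs) ` (A \<times> L)"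
    by (auto simp: set_Cons_def)
  have "inj_on (\<lambda>(x, xs). x # xs) (A \<times> L)" by (auto simp: inj_on_def)
  then show ?thesis
    unfolding eq by (simp add: sum.reindex sum.cartesian_product case_prod_unfold comp_def)
qed

text \<open>The distributive law: expanding a product of sums picks one element from each factor,
  and \<open>listset\<close> is the set of such choices.\<close>

lemma sum_prod_listset:
  fixes f :: "nat \<Rightarrow> 'b \<Rightarrow> 'a::comm_semiring_1"
  shows "(\<Sum>a\<in>listset Bs. \<Prod>i<length Bs. f i (a ! i)) = (\<Prod>i<length Bs. \<Sum>y\<in>Bs ! i. f i y)"
proof (induction Bs arbitrary: f)
  case (Cons B Bs)
  show ?case
    by (simp add: sum_set_Cons prod.lessThan_Suc_shift sum_distrib_left[symmetric]
        sum_distrib_right[symmetric] Cons.IH[of "\<lambda>i. f (Suc i)"] del: prod.lessThan_Suc)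
qed simp

lemma in_listset_iff:
  "a \<in> listset Bs \<longleftrightarrow> length a = length Bs \<and> (\<forall>i<length Bs. a ! i \<in> Bs ! i)"
proof (induction Bs arbitrary: a)
  case (Cons B Bs)
  show ?case
    by (cases a) (auto simp: set_Cons_def Cons.IH nth_Cons less_Suc_eq_0_disj)
qed simp

lemma finite_listset: "(\<And>B. B \<in> set Bs \<Longrightarrow> finite B) \<Longrightarrow> finite (listset Bs)"
proof (induction Bs)
  case (Cons B Bs)
  moreover have "set_Cons B L = (\<lambda>(x, xs). x # xs) ` (B \<times> L)" for L
    by (auto simp: set_Cons_def)
  ultimately show ?case by simp
qed simp

lemma template_tuples_eq_listset:
  "template_tuples X Y \<tau> = listset (map (side_set X Y) \<tau>)"
  by (auto simp: template_tuples_def in_listset_iff)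

lemma swap_side_swap_side: "swap_side (swap_side s) = s"
  by (cases s) auto

lemma complement_complement: "complement (complement \<tau>) = \<tau>"
  by (simp add: complement_def swap_side_swap_side comp_def)

lemma prod_of_bool:
  "finite I \<Longrightarrow> (\<Prod>i\<in>I. of_bool (P i)) = (of_bool (\<forall>i\<in>I. P i) :: 'a::comm_semiring_1)"
  by (induction I rule: finite_induct) auto

text \<open>The kernel is a sum of Kronecker products, one for each \<open>s\<close> in
  \<open>P\<close>. By the mixed product rule its power is a sum over sequences \<open>ss\<close>,
  in which coordinate \<open>i\<close> walks independently with the steps read off column
  \<open>i\<close> of \<open>ss\<close>.\<close>

lemma walk_weight_tensor:
  fixes M :: "'s \<Rightarrow> 'v \<Rightarrow> 'v \<Rightarrow> 'a::comm_semiring_1"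
  assumes "finite W" "a \<in> listset (replicate k W)" "b \<in> listset (replicate k W)"
  shows "walk_weight (listset (replicate k W))
      (replicate m (\<lambda>a b. \<Sum>s\<in>P. \<Prod>i<k. M (s ! i) (a ! i) (b ! i))) a b =
    (\<Sum>ss\<in>listset (replicate m P). \<Prod>i<k. walk_weight W (map (\<lambda>s. M (s ! i)) ss) (a ! i) (b ! i))"
  using assms(2)
proof (induction m arbitrary: a)
  case 0
  have "a = b \<longleftrightarrow> (\<forall>i<k. a ! i = b ! i)"
    using 0 assms by (auto simp: in_listset_iff list_eq_iff_nth_eq)
  then show ?case by (auto simp: prod_of_bool)
next
  case (Suc m)
  let ?L = "listset (replicate k W)" and ?S = "listset (replicate m P)"
  let ?w = "\<lambda>ss i. walk_weight W (map (\<lambda>s. M (s ! i)) ss)"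
  have "walk_weight ?L (replicate (Suc m) (\<lambda>a b. \<Sum>s\<in>P. \<Prod>i<k. M (s ! i) (a ! i) (b ! i))) a b =
    (\<Sum>c\<in>?L. (\<Sum>s\<in>P. \<Prod>i<k. M (s ! i) (a ! i) (c ! i)) * (\<Sum>ss\<in>?S. \<Prod>i<k. ?w ss i (c ! i) (b ! i)))"
    using Suc.IH by simp
  also have "\<dots> = (\<Sum>c\<in>?L. \<Sum>s\<in>P. \<Sum>ss\<in>?S. \<Prod>i<k. M (s ! i) (a ! i) (c ! i) * ?w ss i (c ! i) (b ! i))"
    by (simp add: sum_product prod.distrib)
  also have "\<dots> = (\<Sum>s\<in>P. \<Sum>ss\<in>?S. \<Sum>c\<in>?L. \<Prod>i<k. M (s ! i) (a ! i) (c ! i) * ?w ss i (c ! i) (b ! i))"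
    by (subst sum.swap, intro sum.cong refl, subst sum.swap) simp
  \<comment> \<open>With the sum over the intermediate tuple \<open>c\<close> innermost, it factors
    into separate sums over the coordinates of \<open>c\<close>.\<close>
  also have "\<dots> = (\<Sum>s\<in>P. \<Sum>ss\<in>?S. \<Prod>i<k. \<Sum>x\<in>W. M (s ! i) (a ! i) x * ?w ss i x (b ! i))"
  proof (intro sum.cong refl)
    fix s ss
    show "(\<Sum>c\<in>?L. \<Prod>i<k. M (s ! i) (a ! i) (c ! i) * ?w ss i (c ! i) (b ! i)) =
        (\<Prod>i<k. \<Sum>x\<in>W. M (s ! i) (a ! i) x * ?w ss i x (b ! i))"
      using sum_prod_listset[of "\<lambda>i x. M (s ! i) (a ! i) x * ?w ss i x (b ! i)" "replicate k W"]
      by simp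
  qed
  also have "\<dots> = (\<Sum>ss\<in>listset (replicate (Suc m) P). \<Prod>i<k. ?w ss i (a ! i) (b ! i))"
    by (simp add: sum_set_Cons)
  finally show ?case .
qed

section \<open>Closed walks with a prescribed edge pattern\<close>

locale regular_bipartite =
  fixes G :: "'a ugraph" and X Y :: "'a set" and d :: nat
  assumes bipartite: "bipartite_graph G X Y"
    and regular: "regular_graph d G"
begin

lemma finite_classes: "finite X" "finite Y" and disjoint: "X \<inter> Y = {}" and verts: "verts G = X \<union> Y"
  using bipartite by (auto simp: bipartite_graph_def)

text \<open>Adjacency in the complete bipartite graph on \<open>X\<close> and
  \<open>Y\<close>.\<close>

definition opposite :: "'a \<Rightarrow> 'a \<Rightarrow> bool" where
  "opposite u v \<longleftrightarrow> u \<in> X \<and> v \<in> Y \<or> u \<in> Y \<and> v \<in> X"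

lemma edge_opposite: "{u, v} \<in> edges G \<Longrightarrow> opposite u v"
  using bipartite by (auto simp: bipartite_graph_def opposite_def doubleton_eq_iff)

text \<open>For \<open>True\<close> the adjacency matrix of \<open>G\<close>, for
  \<open>False\<close> that of its bipartite complement. Both vanish inside a class, so every step
  changes sides.\<close>

definition pair_kernel :: "bool \<Rightarrow> 'a \<Rightarrow> 'a \<Rightarrow> complex" where
  "pair_kernel e u v = of_bool (opposite u v \<and> ({u, v} \<in> edges G) = e)"

lemma pair_kernel_sym: "pair_kernel e u v = pair_kernel e v u"
  by (auto simp: pair_kernel_def opposite_def insert_commute)

lemma pair_kernel_True: "pair_kernel True u v = of_bool ({u, v} \<in> edges G)"
  by (auto simp: pair_kernel_def dest: edge_opposite)

lemma pair_kernel_False: "pair_kernel False u v = of_bool (opposite u v) - pair_kernel True u v"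
  by (auto simp: pair_kernel_def)

lemma sum_pair_kernel_True:
  assumes "u \<in> X \<union> Y"
  shows "(\<Sum>w\<in>X \<union> Y. pair_kernel True u w) = of_nat d"
proof -
  have "(\<Sum>w\<in>X \<union> Y. pair_kernel True u w) = of_nat (card ((X \<union> Y) \<inter> {w. {u, w} \<in> edges G}))"
    using finite_classes by (simp add: pair_kernel_True sum_of_bool_eq)
  also have "(X \<union> Y) \<inter> {w. {u, w} \<in> edges G} = {w \<in> verts G. {u, w} \<in> edges G}"
    using verts by auto
  finally show ?thesis using regular assms verts by (simp add: regular_graph_def)
qed

text \<open>A neighbour of \<open>u\<close> is opposite to \<open>v\<close> exactly when
  \<open>u\<close> and \<open>v\<close> lie in the same class. By regularity the left side is
  therefore \<open>d\<close> times the same-class indicator, which is symmetric in \<open>u\<close>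
  and \<open>v\<close>.\<close>

lemma edge_opposite_commute:
  assumes u: "u \<in> X \<union> Y" and v: "v \<in> X \<union> Y"
  shows "(\<Sum>w\<in>X \<union> Y. pair_kernel True u w * of_bool (opposite w v)) =
    (\<Sum>w\<in>X \<union> Y. of_bool (opposite u w) * pair_kernel True w v)"
proof -
  have aux: "(\<Sum>w\<in>X \<union> Y. pair_kernel True u w * of_bool (opposite w v)) =
      of_nat d * of_bool (u \<in> X \<longleftrightarrow> v \<in> X)"
    if "u \<in> X \<union> Y" "v \<in> X \<union> Y" for u v
  proof -
    have "pair_kernel True u w * of_bool (opposite w v) =
        pair_kernel True u w * of_bool (u \<in> X \<longleftrightarrow> v \<in> X)" for w
      using that disjoint by (auto simp: pair_kernel_def opposite_def)
    then have "(\<Sum>w\<in>X \<union> Y. pair_kernel True u w * of_bool (opposite w v)) =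
        (\<Sum>w\<in>X \<union> Y. pair_kernel True u w * of_bool (u \<in> X \<longleftrightarrow> v \<in> X))"
      by (rule sum.cong[OF refl])
    also have "\<dots> = of_nat d * of_bool (u \<in> X \<longleftrightarrow> v \<in> X)"
      unfolding sum_distrib_right[symmetric] sum_pair_kernel_True[OF that(1)] ..
    finally show ?thesis .
  qed
  \<comment> \<open>Both kernels are symmetric, so the product in the other order is the transpose,
    and \<open>aux\<close> applies with \<open>u\<close> and \<open>v\<close> exchanged.\<close>
  have "(\<Sum>w\<in>X \<union> Y. of_bool (opposite u w) * pair_kernel True w v) =
      (\<Sum>w\<in>X \<union> Y. pair_kernel True v w * of_bool (opposite w u))"
    by (intro sum.cong refl) (auto simp: opposite_def pair_kernel_sym[of _ _ v])
  then show ?thesis by (simp only: aux[OF u v] aux[OF v u]) auto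
qed

text \<open>The non-edge kernel is the complete bipartite kernel minus the edge kernel, and the edge
  kernel commutes with both terms.\<close>

lemma pair_kernel_commute:
  assumes "u \<in> X \<union> Y" "v \<in> X \<union> Y"
  shows "(\<Sum>w\<in>X \<union> Y. pair_kernel e u w * pair_kernel e' w v) =
    (\<Sum>w\<in>X \<union> Y. pair_kernel e' u w * pair_kernel e w v)"
proof -
  have "(\<Sum>w\<in>X \<union> Y. pair_kernel True u w * pair_kernel False w v) =
      (\<Sum>w\<in>X \<union> Y. pair_kernel False u w * pair_kernel True w v)"
    using edge_opposite_commute[OF assms]
    by (simp add: pair_kernel_False algebra_simps sum_subtractf)
  then show ?thesis by (cases e; cases e') simp_all
qed

abbreviation pattern_walks :: "bool list \<Rightarrow> 'a \<Rightarrow> 'a \<Rightarrow> complex" where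
  "pattern_walks es \<equiv> walk_weight (X \<union> Y) (map pair_kernel es)"

text \<open>The factor \<open>e\<close> is moved to the end by commuting it past the other factors
  one at a time. This holds entrywise, for walks that need not be closed.\<close>

lemma pattern_walks_rotate:
  assumes "u \<in> X \<union> Y" "v \<in> X \<union> Y"
  shows "pattern_walks (e # es) u v = pattern_walks (es @ [e]) u v"
  using assms(1)
proof (induction es arbitrary: u)
  case (Cons e' es)
  have "pattern_walks (e # e' # es) u v = pattern_walks (e' # e # es) u v"
  proof -
    have swap: "pattern_walks (e # e' # es) u v =
      (\<Sum>z\<in>X \<union> Y. (\<Sum>w\<in>X \<union> Y. pair_kernel e u w * pair_kernel e' w z) * pattern_walks es z v)" for e e'
      by (simp add: sum_distrib_left sum_distrib_right mult.assoc) (rule sum.swap)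
    show ?thesis
      unfolding swap using pair_kernel_commute[OF Cons.prems] by (intro sum.cong) auto
  qed
  also have "\<dots> = pattern_walks (e' # es @ [e]) u v"
    using Cons.IH by (simp only: list.map walk_weight.simps cong: sum.cong)
  finally show ?case by simp
qed simp

text \<open>A closed walk from \<open>X\<close> takes its first step into \<open>Y\<close>. Started
  there instead, it has the rotated pattern, and \<open>pattern_walks_rotate\<close> restores the
  original one. The empty pattern counts the vertices of each class, whence the assumption.\<close>

lemma closed_pattern_walks_eq:
  assumes "es = [] \<Longrightarrow> card X = card Y"
  shows "(\<Sum>x\<in>X. pattern_walks es x x) = (\<Sum>y\<in>Y. pattern_walks es y y)"
proof (cases es)
  case (Cons e es')
  have XY: "finite (X \<union> Y)" using finite_classes by simp
  have left: "(\<Sum>x\<in>X. pattern_walks es x x) = (\<Sum>x\<in>X. \<Sum>w\<in>Y. pair_kernel e x w * pattern_walks es' w x)"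
    unfolding Cons list.map walk_weight.simps
    using disjoint XY by (intro sum.cong refl sum.mono_neutral_right) (auto simp: pair_kernel_def opposite_def)
  have "(\<Sum>y\<in>Y. pattern_walks es y y) = (\<Sum>y\<in>Y. pattern_walks (es' @ [e]) y y)"
    unfolding Cons by (intro sum.cong refl pattern_walks_rotate) auto
  also have "\<dots> = (\<Sum>y\<in>Y. \<Sum>w\<in>X \<union> Y. pattern_walks es' y w * pair_kernel e w y)"
    using XY by (simp add: walk_weight_snoc cong: sum.cong)
  also have "\<dots> = (\<Sum>y\<in>Y. \<Sum>w\<in>X. pattern_walks es' y w * pair_kernel e w y)"
    using disjoint XY by (intro sum.cong refl sum.mono_neutral_right) (auto simp: pair_kernel_def opposite_def)
  also have "\<dots> = (\<Sum>x\<in>X. \<Sum>w\<in>Y. pair_kernel e x w * pattern_walks es' w x)"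
    by (subst sum.swap) (simp add: mult.commute)
  finally show ?thesis using left by simp
qed (use assms in simp)

text \<open>Counts the edges from both classes, as closed walks of two edge steps. The pattern is
  nonempty, so \<open>closed_pattern_walks_eq\<close> applies without presupposing equal
  classes.\<close>

lemma card_classes_eq:
  assumes "d \<ge> 1"
  shows "card X = card Y"
proof -
  have *: "(\<Sum>u\<in>Z. pattern_walks [True, True] u u) = of_nat (card Z * d)" if "Z \<subseteq> X \<union> Y" for Z
  proof -
    have "pattern_walks [True, True] u u = of_nat d" if "u \<in> Z" for u
    proof -
      have "pattern_walks [True, True] u u = (\<Sum>w\<in>X \<union> Y. pair_kernel True u w * pair_kernel True w u)"
        using walk_weight_snoc[of "X \<union> Y" u u "[pair_kernel True]" "pair_kernel True"]
          finite_classes that \<open>Z \<subseteq> X \<union> Y\<close>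
        by (auto simp: of_bool_def if_distrib[of "(*) _"] cong: if_cong sum.cong)
      \<comment> \<open>The walk returns along the edge it came by, and the square of an indicator
        is itself.\<close>
      also have "\<dots> = (\<Sum>w\<in>X \<union> Y. pair_kernel True u w)"
        by (intro sum.cong) (auto simp: pair_kernel_True insert_commute)
      finally show ?thesis using sum_pair_kernel_True that \<open>Z \<subseteq> X \<union> Y\<close> by auto
    qed
    then show ?thesis by simp
  qed
  have "complex_of_nat (card X * d) = of_nat (card Y * d)"
    using *[of X] *[of Y] closed_pattern_walks_eq[of "[True, True]"] by simp
  then have "card X * d = card Y * d" by (simp only: of_nat_eq_iff)
  then show ?thesis using assms by simp
qed

section \<open>Closed walks in the bipartite graph products\<close>

text \<open>The admissible patterns of a single step in the product: entry \<open>i\<close> records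
  whether coordinate \<open>i\<close> moves along an edge.\<close>

definition edge_patterns :: "nat \<Rightarrow> nat \<Rightarrow> bool list set" where
  "edge_patterns k t = {s. length s = k \<and> t \<le> card {i. i < k \<and> s ! i}}"

lemma finite_edge_patterns: "finite (edge_patterns k t)"
  using finite_lists_length_eq[of "UNIV :: bool set" k]
  by (rule rev_finite_subset) (auto simp: edge_patterns_def)

text \<open>Writes the threshold condition as a sum of Kronecker products, the form required by
  \<open>walk_weight_tensor\<close>. At most one pattern contributes, namely the actual edge pattern
  of the pair of tuples.\<close>

lemma sum_edge_patterns:
  "(\<Sum>s\<in>edge_patterns k t. \<Prod>i<k. pair_kernel (s ! i) (a ! i) (b ! i)) =
    of_bool ((\<forall>i<k. opposite (a ! i) (b ! i)) \<and> t \<le> card {i. i < k \<and> {a ! i, b ! i} \<in> edges G})"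
proof -
  define s0 where "s0 = map (\<lambda>i. {a ! i, b ! i} \<in> edges G) [0..<k]"
  have s0: "(\<forall>i<k. s ! i = ({a ! i, b ! i} \<in> edges G)) \<longleftrightarrow> s = s0" if "length s = k" for s
    using that by (auto simp: s0_def list_eq_iff_nth_eq)
  have "(\<Sum>s\<in>edge_patterns k t. \<Prod>i<k. pair_kernel (s ! i) (a ! i) (b ! i)) =
      (\<Sum>s\<in>edge_patterns k t. if s = s0 then of_bool (\<forall>i<k. opposite (a ! i) (b ! i)) else 0)"
  proof (intro sum.cong refl)
    fix s assume "s \<in> edge_patterns k t"
    then have "length s = k" by (simp add: edge_patterns_def)
    then show "(\<Prod>i<k. pair_kernel (s ! i) (a ! i) (b ! i)) =
        (if s = s0 then of_bool (\<forall>i<k. opposite (a ! i) (b ! i)) else 0)"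
      using s0[of s] by (auto simp: pair_kernel_def prod_of_bool)
  qed
  also have "\<dots> = of_bool (s0 \<in> edge_patterns k t \<and> (\<forall>i<k. opposite (a ! i) (b ! i)))"
    using finite_edge_patterns by simp
  also have "{i. i < k \<and> s0 ! i} = {i. i < k \<and> {a ! i, b ! i} \<in> edges G}"
    by (auto simp: s0_def)
  then have "s0 \<in> edge_patterns k t \<longleftrightarrow> t \<le> card {i. i < k \<and> {a ! i, b ! i} \<in> edges G}"
    by (simp add: edge_patterns_def) (simp add: s0_def)
  finally show ?thesis by (simp add: conj_commute)
qed

section \<open>Sides, templates and their complements\<close>

lemma in_side_set_swap: "u \<in> side_set X Y (swap_side s) \<Longrightarrow> v \<in> side_set X Y s \<Longrightarrow> opposite u v"
  by (cases s) (auto simp: opposite_def)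

lemma opposite_side_set:
  "opposite u v \<Longrightarrow> u \<in> side_set X Y s \<Longrightarrow> v \<in> side_set X Y (swap_side s)"
  using disjoint by (cases s) (auto simp: opposite_def)

lemma opposite_sym: "opposite u v = opposite v u"
  by (auto simp: opposite_def)

lemma opposite_same_side: "opposite u v \<Longrightarrow> u \<in> side_set X Y s \<Longrightarrow> v \<notin> side_set X Y s"
  using disjoint by (cases s) (auto simp: opposite_def)

lemma opposite_template_tuples:
  assumes "a \<in> template_tuples X Y \<tau>" "length b = length \<tau>" "\<forall>i<length \<tau>. opposite (a ! i) (b ! i)"
  shows "b \<in> template_tuples X Y (complement \<tau>)"
  using assms by (auto simp: template_tuples_def complement_def intro: opposite_side_set)

lemma template_tuples_complement_opposite:
  assumes "a \<in> template_tuples X Y \<tau>" "b \<in> template_tuples X Y (complement \<tau>)" "i < length \<tau>"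
  shows "opposite (a ! i) (b ! i)"
  using assms by (subst opposite_sym, intro in_side_set_swap[of _ "\<tau> ! i"])
    (auto simp: template_tuples_def complement_def)

context
  fixes k t :: nat
  assumes k: "k \<ge> 1" and t: "t \<ge> 1"
begin

lemma template_tuples_subset:
  assumes "length \<tau> = k"
  shows "template_tuples X Y \<tau> \<subseteq> listset (replicate k (X \<union> Y))"
proof
  fix a assume a: "a \<in> template_tuples X Y \<tau>"
  have "side_set X Y s \<subseteq> X \<union> Y" for s by (cases s) auto
  then show "a \<in> listset (replicate k (X \<union> Y))"
    using a assms by (auto simp: template_tuples_def in_listset_iff)
qed

text \<open>Since \<open>t\<close> \<ge> 1, adjacent tuples have an edge in some coordinate. This
  rules out equal templates, so the templates are complementary and all coordinates are
  opposite.\<close>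

lemma BGP_edge:
  assumes \<tau>: "length \<tau> = k" and V: "a \<in> verts (BGP k t \<tau> X Y G)" "b \<in> verts (BGP k t \<tau> X Y G)"
  shows "{a, b} \<in> edges (BGP k t \<tau> X Y G) \<longleftrightarrow>
    (\<forall>i<k. opposite (a ! i) (b ! i)) \<and> t \<le> card {i. i < k \<and> {a ! i, b ! i} \<in> edges G}"
proof -
  have edge: "{a, b} \<in> edges (BGP k t \<tau> X Y G) \<longleftrightarrow> t \<le> card {i. i < k \<and> {a ! i, b ! i} \<in> edges G}"
    using V by (auto simp: BGP_def Let_def doubleton_eq_iff insert_commute)
  have "\<forall>i<k. opposite (a ! i) (b ! i)" if "t \<le> card {i. i < k \<and> {a ! i, b ! i} \<in> edges G}"
  proof -
    have "{i. i < k \<and> {a ! i, b ! i} \<in> edges G} \<noteq> {}" using that t by force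
    then obtain i where i: "i < k" "opposite (a ! i) (b ! i)" using edge_opposite by blast
    \<comment> \<open>Tuples with a common template would have both ends of that edge in one
      class.\<close>
    have False if "a \<in> template_tuples X Y \<sigma>" "b \<in> template_tuples X Y \<sigma>" "length \<sigma> = k" for \<sigma>
      using that i opposite_same_side by (auto simp: template_tuples_def)
    moreover have "length (complement \<tau>) = k" using \<tau> by (simp add: complement_def)
    ultimately consider "a \<in> template_tuples X Y \<tau>" "b \<in> template_tuples X Y (complement \<tau>)"
      | "b \<in> template_tuples X Y \<tau>" "a \<in> template_tuples X Y (complement \<tau>)"
      using V \<tau> by (auto simp: BGP_def Let_def)
    then show ?thesis
      using template_tuples_complement_opposite \<tau> opposite_sym by cases blast+
  qed
  then show ?thesis using edge by blast
qed

text \<open>Passes from the vertices of \<open>BGP\<close> to all \<open>k\<close>-tuples, where the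
  tensor formula applies. The added tuples do no harm: every step with nonzero weight exchanges the
  template and its complement, so a walk starting in \<open>BGP\<close> stays there.\<close>

lemma walk_weight_BGP:
  assumes \<tau>: "length \<tau> = k" and V: "a \<in> verts (BGP k t \<tau> X Y G)" "b \<in> verts (BGP k t \<tau> X Y G)"
  shows "walk_weight (verts (BGP k t \<tau> X Y G))
      (replicate m (\<lambda>a b. of_bool ({a, b} \<in> edges (BGP k t \<tau> X Y G)))) a b =
    walk_weight (listset (replicate k (X \<union> Y)))
      (replicate m (\<lambda>a b. \<Sum>s\<in>edge_patterns k t. \<Prod>i<k. pair_kernel (s ! i) (a ! i) (b ! i))) a b"
  using V(1)
proof (induction m arbitrary: a)
  case (Suc m)
  let ?B = "BGP k t \<tau> X Y G" and ?L = "listset (replicate k (X \<union> Y))"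
  let ?K = "\<lambda>a b. \<Sum>s\<in>edge_patterns k t. \<Prod>i<k. pair_kernel (s ! i) (a ! i) (b ! i)"
  have len: "length (complement \<tau>) = k" using \<tau> by (simp add: complement_def)
  have sub: "verts ?B \<subseteq> ?L"
    using template_tuples_subset[OF \<tau>] template_tuples_subset[OF len] by (auto simp: BGP_def Let_def)
  have fin: "finite ?L" using finite_classes by (intro finite_listset) auto
  have zero: "?K a c = 0" if "c \<in> ?L - verts ?B" for c
  proof (rule ccontr)
    assume "?K a c \<noteq> 0"
    then have "\<forall>i<k. opposite (a ! i) (c ! i)"
      unfolding sum_edge_patterns by (simp split: if_splits)
    moreover have "length c = k" using that by (simp add: in_listset_iff)
    ultimately have "c \<in> verts ?B"
      using Suc.prems opposite_template_tuples[of a \<tau> c] opposite_template_tuples[of a "complement \<tau>" c] \<tau> len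
      by (auto simp: BGP_def Let_def complement_complement)
    then show False using that by simp
  qed
  have "walk_weight (verts ?B) (replicate (Suc m) (\<lambda>a b. of_bool ({a, b} \<in> edges ?B))) a b =
      (\<Sum>c\<in>verts ?B. ?K a c * walk_weight ?L (replicate m ?K) c b)"
    unfolding replicate_Suc walk_weight.simps
    using Suc BGP_edge[OF \<tau>] by (intro sum.cong refl) (simp only: sum_edge_patterns)
  also have "\<dots> = (\<Sum>c\<in>?L. ?K a c * walk_weight ?L (replicate m ?K) c b)"
    using sub fin zero by (intro sum.mono_neutral_left) auto
  finally show ?case by simp
qed simp

lemma finite_BGP: "finite (verts (BGP k t \<tau> X Y G))"
proof -
  have "finite (side_set X Y s)" for s using finite_classes by (cases s) auto
  then show ?thesis
    by (auto simp: BGP_def Let_def template_tuples_eq_listset intro!: finite_listset)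
qed

text \<open>Here the template disappears: the sum factors over the coordinates, and each factor is
  the same for \<open>X\<close> and for \<open>Y\<close>. Equal class sizes cover empty
  patterns.\<close>

lemma sum_template_tuples:
  assumes \<tau>: "length \<tau> = k" and XY: "card X = card Y"
  shows "(\<Sum>a\<in>template_tuples X Y \<tau>. \<Prod>i<k. pattern_walks (es i) (a ! i) (a ! i)) =
    (\<Prod>i<k. \<Sum>x\<in>X. pattern_walks (es i) x x)"
proof -
  have "(\<Sum>x\<in>side_set X Y s. pattern_walks es x x) = (\<Sum>x\<in>X. pattern_walks es x x)" for s es
    using closed_pattern_walks_eq[OF XY] by (cases s) auto
  then show ?thesis
    using sum_prod_listset[of "\<lambda>i x. pattern_walks (es i) x x" "map (side_set X Y) \<tau>"] \<tau>
    by (simp add: template_tuples_eq_listset)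
qed

text \<open>The right side does not mention \<open>\<tau>\<close>. The factor 2 arises because the
  template and its complement contribute equally.\<close>

lemma closed_walks_BGP:
  assumes \<tau>: "length \<tau> = k" and XY: "card X = card Y"
  shows "(\<Sum>a\<in>verts (BGP k t \<tau> X Y G). walk_weight (verts (BGP k t \<tau> X Y G))
      (replicate m (\<lambda>a b. of_bool ({a, b} \<in> edges (BGP k t \<tau> X Y G)))) a a) =
    2 * (\<Sum>ss\<in>listset (replicate m (edge_patterns k t)).
      \<Prod>i<k. \<Sum>x\<in>X. pattern_walks (map (\<lambda>s. s ! i) ss) x x)"
    (is "?lhs = 2 * ?rhs")
proof -
  have len: "length (complement \<tau>) = k" using \<tau> by (simp add: complement_def)
  have V: "verts (BGP k t \<tau> X Y G) = template_tuples X Y \<tau> \<union> template_tuples X Y (complement \<tau>)"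
    by (simp add: BGP_def Let_def)
  have fin: "finite (template_tuples X Y \<tau>)" "finite (template_tuples X Y (complement \<tau>))"
    using finite_BGP[of \<tau>] by (auto simp: V)
  \<comment> \<open>Coordinate 0 exists because \<open>k\<close> \<ge> 1. A tuple with both
    templates would have an entry there opposite to itself.\<close>
  have "a \<notin> template_tuples X Y (complement \<tau>)" if "a \<in> template_tuples X Y \<tau>" for a
    using template_tuples_complement_opposite[OF that, of a 0] k \<tau> disjoint by (auto simp: opposite_def)
  then have disj: "template_tuples X Y \<tau> \<inter> template_tuples X Y (complement \<tau>) = {}" by blast
  let ?S = "listset (replicate m (edge_patterns k t))"
  let ?f = "\<lambda>a. \<Sum>ss\<in>?S. \<Prod>i<k. pattern_walks (map (\<lambda>s. s ! i) ss) (a ! i) (a ! i)"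
  have half: "(\<Sum>a\<in>template_tuples X Y \<sigma>. ?f a) = ?rhs" if "length \<sigma> = k" for \<sigma>
    by (subst sum.swap, intro sum.cong refl, rule sum_template_tuples[OF that XY])
  have "?lhs = (\<Sum>a\<in>verts (BGP k t \<tau> X Y G). ?f a)"
  proof (intro sum.cong refl)
    fix a assume a: "a \<in> verts (BGP k t \<tau> X Y G)"
    then have "a \<in> listset (replicate k (X \<union> Y))"
      using template_tuples_subset[OF \<tau>] template_tuples_subset[OF len] by (auto simp: V)
    then show "walk_weight (verts (BGP k t \<tau> X Y G))
        (replicate m (\<lambda>a b. of_bool ({a, b} \<in> edges (BGP k t \<tau> X Y G)))) a a = ?f a"
      unfolding walk_weight_BGP[OF \<tau> a a]
      using finite_classes by (subst walk_weight_tensor) (auto simp: comp_def)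
  qed
  also have "\<dots> = 2 * ?rhs"
    unfolding V sum.union_disjoint[OF fin disj] half[OF \<tau>] half[OF len] by simp
  finally show ?thesis .
qed

end

end

theorem theorem8:
  fixes G :: "'a ugraph" and X Y :: "'a set" and d k t :: nat and \<tau> \<tau>' :: template
  assumes "bipartite_graph G X Y"
    and "regular_graph d G"
    and "d \<ge> 1 \<or> card X = card Y"
    and "k \<ge> 1" and "1 \<le> t" and "t \<le> k"
    and "length \<tau> = k" and "length \<tau>' = k"
  shows "cospectral (BGP k t \<tau> X Y G) (BGP k t \<tau>' X Y G)"
proof -
  interpret regular_bipartite G X Y d
    using assms by unfold_locales
  have XY: "card X = card Y" using assms(3) card_classes_eq by blast
  show ?thesis
    \<comment> \<open>For every \<open>m\<close> both closed walk counts become the same expression,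
      free of templates.\<close>
    using assms XY
    by (intro cospectral_if_closed_walks_eq finite_BGP) (simp_all only: closed_walks_BGP)
qed

end
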